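(* Let $\varepsilon>0$ and let $s_i^{\varepsilon}:S\to\{I,NI\}$ be the $\varepsilon$-good strategy of player $i$, for $i=1,2,3$. Then for every $x_1\in S$ the trajectory $\bar{x}_T=\bar{x}_T((s_1^{\varepsilon},s_2^{\varepsilon},s_3^{\varepsilon}),x_1)$ satisfies $$\lim_{T\to\infty}\bar{x}_T=B,\qquad\text{where } B=(p_3,p_3,p_3).$$
   Context: Stage game. There are three players $1,2,3$, each with the two actions $I$ (invest) and $NI$ (not invest). The game is symmetric: if exactly $n$ players invest, each investing player receives $p_n$ ($n=1,2,3$) and each non-investing player receives $r_n$ ($n=0,1,2$). Let $G:\{I,NI\}^3\to\mathbb{R}^3$ be the resulting vector payoff function (coordinate $i$ of $G(a)$ is the payoff of player $i$ under action profile $a$). Standing assumptions on the real numbers $r_0,r_1,r_2,p_1,p_2,p_3$: $0<r_0<r_1<r_2$; $0<p_1<p_2<p_3$; $p_1<r_0$; $3r_0<p_1+2r_1<2p_2+r_2<3p_3$; $p_1+r_1<2p_3$; $p_2<r_2$. Let $S\subset\mathbb{R}^3$ be the convex hull of the eight payoff vectors $G(a)$, $a\in\{I,NI\}^3$. Repeated game. A strategy of player $i$ is an arbitrary function $s_i:S\to\{I,NI\}$; a strategy profile is $s=(s_1,s_2,s_3):S\to\{I,NI\}^3$. Put $\varphi=G\circ s:S\to S$. For $x_1\in S$ the trajectory $\bar{x}_n=\bar{x}_n(s,x_1)$ is defined by $\bar{x}_1=x_1$ and $\bar{x}_{n+1}=\frac{n\bar{x}_n+\varphi(\bar{x}_n)}{n+1}$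 for $n\ge 1$. $\varepsilon$-good strategy. For $\varepsilon>0$ and $\{i,j,k\}=\{1,2,3\}$ let $\Omega_i^{\varepsilon}=\{x\in S: x_i>x_j-\varepsilon \text{ and } x_i>x_k-\varepsilon\}$, $W_i=\{x\in S: x_i<r_0 \text{ or } x_j+x_k>2p_3\}$, $V_i=\Omega_i^{\varepsilon}\setminus W_i$. The $\varepsilon$-good strategy of player $i$ is $s_i^{\varepsilon}(x)=I$ if $x\in V_i$ and $s_i^{\varepsilon}(x)=NI$ if $x\in S\setminus V_i$. *)

theory Defs
  imports "HOL-Analysis.Analysis"
begin

text \<open>
  The players 1, 2, 3 are the elements of the numeral type \<open>3\<close> (in which \<open>3 = 0\<close>).
  The payoff parameters are functions on \<open>nat\<close>, of which only the values
  \<open>p 1, p 2, p 3\<close> and \<open>r 0, r 1, r 2\<close> are ever used.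
\<close>

datatype action = Invest | NotInvest

definition admissible_payoffs :: "(nat \<Rightarrow> real) \<Rightarrow> (nat \<Rightarrow> real) \<Rightarrow> bool" where
  "admissible_payoffs p r \<longleftrightarrow>
     0 < r 0 \<and> r 0 < r 1 \<and> r 1 < r 2 \<and>
     0 < p 1 \<and> p 1 < p 2 \<and> p 2 < p 3 \<and>
     p 1 < r 0 \<and>
     3 * r 0 < p 1 + 2 * r 1 \<and> p 1 + 2 * r 1 < 2 * p 2 + r 2 \<and> 2 * p 2 + r 2 < 3 * p 3 \<and>
     p 1 + r 1 < 2 * p 3 \<and>
     p 2 < r 2"

definition payoff :: "(nat \<Rightarrow> real) \<Rightarrow> (nat \<Rightarrow> real) \<Rightarrow> (3 \<Rightarrow> action) \<Rightarrow> real ^ 3" where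
  "payoff p r a =
     (\<chi> i. let n = card {j. a j = Invest} in if a i = Invest then p n else r n)"

definition payoff_hull :: "(nat \<Rightarrow> real) \<Rightarrow> (nat \<Rightarrow> real) \<Rightarrow> (real ^ 3) set" where
  "payoff_hull p r = convex hull (range (payoff p r))"

text \<open>
  A strategy of a player is a function from \<open>S = payoff_hull p r\<close> to actions. It is represented
  by a total function on \<open>real ^ 3\<close>, whose values outside \<open>S\<close> are irrelevant: trajectories that
  start in \<open>S\<close> stay in \<open>S\<close> (lemma \<open>trajectory_in_payoff_hull\<close>).
\<close>

definition profile_payoff ::
    "(nat \<Rightarrow> real) \<Rightarrow> (nat \<Rightarrow> real) \<Rightarrow> (3 \<Rightarrow> real ^ 3 \<Rightarrow> action) \<Rightarrow> real ^ 3 \<Rightarrow> real ^ 3" where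
  "profile_payoff p r s x = payoff p r (\<lambda>i. s i x)"

text \<open>The trajectory is indexed from 1; the value at index 0 is a dummy.\<close>

primrec trajectory ::
    "(nat \<Rightarrow> real) \<Rightarrow> (nat \<Rightarrow> real) \<Rightarrow> (3 \<Rightarrow> real ^ 3 \<Rightarrow> action) \<Rightarrow> real ^ 3 \<Rightarrow> nat \<Rightarrow> real ^ 3" where
  "trajectory p r s x\<^sub>1 0 = x\<^sub>1"
| "trajectory p r s x\<^sub>1 (Suc n) =
     (if n = 0 then x\<^sub>1
      else (real n *\<^sub>R trajectory p r s x\<^sub>1 n + profile_payoff p r s (trajectory p r s x\<^sub>1 n))
             /\<^sub>R (real n + 1))"

lemma trajectory_in_payoff_hull:
  assumes "x\<^sub>1 \<in> payoff_hull p r"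
  shows "trajectory p r s x\<^sub>1 n \<in> payoff_hull p r"
proof (induction n)
  case 0
  then show ?case using assms by simp
next
  case (Suc n)
  let ?x = "trajectory p r s x\<^sub>1 n"
  have G: "profile_payoff p r s ?x \<in> payoff_hull p r"
    unfolding profile_payoff_def payoff_hull_def by (rule hull_inc) simp
  have "(real n / (real n + 1)) *\<^sub>R ?x + (1 / (real n + 1)) *\<^sub>R profile_payoff p r s ?x
          \<in> payoff_hull p r"
    by (rule convexD[OF _ Suc G]) (simp_all add: payoff_hull_def add_divide_distrib[symmetric])
  then show ?case
    using assms by (simp add: scaleR_add_right divide_inverse mult.commute)
qed

definition Omega_set ::
    "(nat \<Rightarrow> real) \<Rightarrow> (nat \<Rightarrow> real) \<Rightarrow> real \<Rightarrow> 3 \<Rightarrow> (real ^ 3) set" where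
  "Omega_set p r \<epsilon> i = {x \<in> payoff_hull p r. \<forall>j. j \<noteq> i \<longrightarrow> x $ i > x $ j - \<epsilon>}"

definition W_set :: "(nat \<Rightarrow> real) \<Rightarrow> (nat \<Rightarrow> real) \<Rightarrow> 3 \<Rightarrow> (real ^ 3) set" where
  "W_set p r i = {x \<in> payoff_hull p r. x $ i < r 0 \<or> (\<Sum>j\<in>UNIV - {i}. x $ j) > 2 * p 3}"

definition V_set ::
    "(nat \<Rightarrow> real) \<Rightarrow> (nat \<Rightarrow> real) \<Rightarrow> real \<Rightarrow> 3 \<Rightarrow> (real ^ 3) set" where
  "V_set p r \<epsilon> i = Omega_set p r \<epsilon> i - W_set p r i"

definition good_strategy ::
    "(nat \<Rightarrow> real) \<Rightarrow> (nat \<Rightarrow> real) \<Rightarrow> real \<Rightarrow> 3 \<Rightarrow> real ^ 3 \<Rightarrow> action" where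
  "good_strategy p r \<epsilon> i x = (if x \<in> V_set p r \<epsilon> i then Invest else NotInvest)"

end

theory Submission
  imports Defs
begin

text \<open>
  A richest player always invests, since the coordinate sum of a point of \<open>S\<close> lies between
  \<open>3 r\<^sub>0\<close> and \<open>3 p\<^sub>3\<close>. Moreover, if a player invests then so does every richer player. In each
  round an investor earns less than a non-investor, so the difference of two coordinates, multiplied
  by \<open>n\<close>, moves towards \<open>0\<close> by bounded steps and hence stays bounded: the coordinates approach each
  other at rate \<open>1/n\<close>. As someone invests in each round, the coordinate sum has limit inferior at
  least \<open>p\<^sub>1 + 2 r\<^sub>1 > 3 r\<^sub>0\<close>. Thus eventually a player abstains only if two coordinates sum to
  more than \<open>2 p\<^sub>3\<close>, and then the total is within \<open>O(1/n)\<close> of \<open>3 p\<^sub>3\<close>. When all invest, \<open>n\<close> times the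
  deficit of the total does not change; hence it is bounded, and the total converges to \<open>3 p\<^sub>3\<close>.
\<close>

section \<open>Bounds for scalar recursions\<close>

lemma le_max_of_step_le_max:
  fixes f :: "nat \<Rightarrow> 'a :: linorder"
  assumes "\<And>n. n \<ge> N \<Longrightarrow> f (Suc n) \<le> max (f n) K" and "n \<ge> N"
  shows "f n \<le> max (f N) K"
  using assms(2)
proof (induction n rule: dec_induct)
  case (step n)
  then show ?case using assms(1)[of n] by (auto simp: max_def split: if_splits)
qed simp

text \<open>A step points towards 0. Either it does not cross 0 and the modulus does not grow, or it
  overshoots and lands within the step size \<open>C\<close> of 0.\<close>

lemma bounded_of_restoring_steps:
  fixes f :: "nat \<Rightarrow> real"
  assumes step: "\<And>n. n \<ge> N \<Longrightarrow> f (Suc n) = f n + e n"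
    and bound: "\<And>n. \<bar>e n\<bar> \<le> C"
    and restoring: "\<And>n. n \<ge> N \<Longrightarrow> f n \<ge> 0 \<Longrightarrow> e n \<le> 0"
      "\<And>n. n \<ge> N \<Longrightarrow> f n \<le> 0 \<Longrightarrow> e n \<ge> 0"
    and "n \<ge> N"
  shows "\<bar>f n\<bar> \<le> max \<bar>f N\<bar> C"
proof (rule le_max_of_step_le_max[OF _ \<open>n \<ge> N\<close>])
  fix n assume "n \<ge> N"
  then show "\<bar>f (Suc n)\<bar> \<le> max \<bar>f n\<bar> C"
    using step[of n] bound[of n] restoring[of n] by linarith
qed

section \<open>Total payoff as a function of the number of investors\<close>

lemma card_investors_le: "card {j :: 3. a j = Invest} \<le> 3"
  using card_mono[of UNIV "{j :: 3. a j = Invest}"] by simp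

lemma card_investors_pos: "a i = Invest \<Longrightarrow> card {j :: 3. a j = Invest} \<ge> 1"
  by (metis (mono_tags) One_nat_def Suc_leI card_gt_0_iff empty_iff finite_code mem_Collect_eq)

lemma card_investors_less:
  assumes "a i \<noteq> Invest"
  shows "card {j :: 3. a j = Invest} \<le> 2"
proof -
  have "card {j :: 3. a j = Invest} < card (UNIV :: 3 set)"
    using assms by (intro psubset_card_mono) auto
  then show ?thesis by simp
qed

lemma nat_le_3_cases: "(n :: nat) \<le> 3 \<Longrightarrow> n = 0 \<or> n = 1 \<or> n = 2 \<or> n = 3"
  by auto

lemma sum_payoff:
  fixes a :: "3 \<Rightarrow> action"
  defines "n \<equiv> card {j. a j = Invest}"
  shows "(\<Sum>i\<in>UNIV. payoff p r a $ i) = real n * p n + (3 - real n) * r n"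
proof -
  have "card (- {j. a j = Invest}) = 3 - n"
    unfolding Compl_eq_Diff_UNIV n_def by (subst card_Diff_subset) auto
  moreover have "n \<le> 3" unfolding n_def by (rule card_investors_le)
  ultimately show ?thesis
    by (simp add: payoff_def Let_def sum.If_cases n_def[symmetric] Collect_neg_eq of_nat_diff)
qed

text \<open>Admissibility makes the total payoff increase with the number of investors, so the
  extremes occur at 0 and 3 investors.\<close>

lemma sum_payoff_bounds:
  assumes "admissible_payoffs p r"
  shows "3 * r 0 \<le> (\<Sum>i\<in>UNIV. payoff p r a $ i)" "(\<Sum>i\<in>UNIV. payoff p r a $ i) \<le> 3 * p 3"
  using nat_le_3_cases[OF card_investors_le[of a]] assms
  by (auto simp: sum_payoff admissible_payoffs_def)

lemma sum_payoff_ge_of_investor: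
  assumes "admissible_payoffs p r" "a i = Invest"
  shows "p 1 + 2 * r 1 \<le> (\<Sum>i\<in>UNIV. payoff p r a $ i)"
  using nat_le_3_cases[OF card_investors_le[of a]] card_investors_pos[of a i] assms
  by (auto simp: sum_payoff admissible_payoffs_def)

lemma sum_payoff_all_invest: "(\<And>i. a i = Invest) \<Longrightarrow> (\<Sum>i\<in>UNIV. payoff p r a $ i) = 3 * p 3"
  by (simp add: sum_payoff)

lemma payoff_hull_sum_bounds:
  assumes "admissible_payoffs p r" "x \<in> payoff_hull p r"
  shows "3 * r 0 \<le> (\<Sum>i\<in>UNIV. x $ i)" "(\<Sum>i\<in>UNIV. x $ i) \<le> 3 * p 3"
proof -
  have "payoff_hull p r \<subseteq> {x. 1 \<bullet> x \<ge> 3 * r 0} \<inter> {x. 1 \<bullet> x \<le> 3 * p 3}"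
    unfolding payoff_hull_def
    by (intro hull_minimal convex_Int convex_halfspace_ge convex_halfspace_le)
      (use sum_payoff_bounds[OF assms(1)] in \<open>auto simp: inner_vec_def\<close>)
  then show "3 * r 0 \<le> (\<Sum>i\<in>UNIV. x $ i)" "(\<Sum>i\<in>UNIV. x $ i) \<le> 3 * p 3"
    using assms(2) by (auto simp: inner_vec_def)
qed

section \<open>Monotonicity of the good strategies\<close>

lemma sum_others: "(\<Sum>j\<in>UNIV - {i}. x $ j) = (\<Sum>j\<in>UNIV. x $ j) - (x :: real ^ 3) $ i"
  by (simp add: sum_diff1)

lemma good_strategy_invest_iff:
  assumes "x \<in> payoff_hull p r"
  shows "good_strategy p r \<epsilon> i x = Invest \<longleftrightarrow>
    (\<forall>j. j \<noteq> i \<longrightarrow> x $ i > x $ j - \<epsilon>) \<and> x $ i \<ge> r 0 \<and> (\<Sum>j\<in>UNIV. x $ j) - x $ i \<le> 2 * p 3"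
  using assms
  by (auto simp: good_strategy_def V_set_def Omega_set_def W_set_def sum_others not_less)

text \<open>The largest coordinate is at least the mean, hence at least \<open>r 0\<close>; the
  other two sum to at most two thirds of the total, hence at most \<open>2 * p 3\<close>.\<close>

lemma richest_invests:
  assumes "admissible_payoffs p r" "\<epsilon> > 0" and x: "x \<in> payoff_hull p r"
    and max: "\<And>j. x $ j \<le> x $ i"
  shows "good_strategy p r \<epsilon> i x = Invest"
proof -
  have "(\<Sum>j\<in>UNIV. x $ j) \<le> 3 * x $ i"
    using sum_bounded_above[of UNIV "($) x" "x $ i"] max by simp
  moreover have "x $ i > x $ j - \<epsilon>" for j
    using max[of j] \<open>\<epsilon> > 0\<close> by linarith
  ultimately show ?thesis
    using payoff_hull_sum_bounds[OF assms(1) x]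
    unfolding good_strategy_invest_iff[OF x] by auto
qed

lemma ex_investor:
  assumes "admissible_payoffs p r" "\<epsilon> > 0" "x \<in> payoff_hull p r"
  obtains i where "good_strategy p r \<epsilon> i x = Invest"
proof -
  have "Max (range (($) x)) \<in> range (($) x)"
    by (intro Max_in) auto
  then obtain i where "Max (range (($) x)) = x $ i" by blast
  then have "x $ j \<le> x $ i" for j
    by (metis Max_ge finite finite_imageI rangeI)
  then show thesis
    using that richest_invests[OF assms] by blast
qed

text \<open>For a fixed point \<open>x\<close>, each of the three conditions for investing only gets
  easier as the player's own coordinate grows.\<close>

lemma richer_invests:
  assumes "\<epsilon> > 0" and x: "x \<in> payoff_hull p r" and "x $ j \<le> x $ i"
    and "good_strategy p r \<epsilon> j x = Invest"
  shows "good_strategy p r \<epsilon> i x = Invest"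
proof -
  have "x $ i > x $ k - \<epsilon>" for k
    \<comment> \<open>The condition on \<open>j\<close> does not compare \<open>j\<close> with
      itself; for \<open>k = j\<close> the claim follows from \<open>x $ j \<le> x $ i\<close> and
      \<open>\<epsilon> > 0\<close>.\<close>
    using assms(1,3,4) unfolding good_strategy_invest_iff[OF x] by (cases "k = j") (auto intro: less_le_trans)
  then show ?thesis
    using assms(3,4) unfolding good_strategy_invest_iff[OF x] by auto
qed

text \<open>Equal actions earn equally. Otherwise only the richer player \<open>i\<close> invests,
  so there are 1 or 2 investors, and \<open>p 1 < r 0 < r 1\<close> or \<open>p 2 < r 2\<close>
  applies.\<close>

lemma richer_earns_less:
  assumes "admissible_payoffs p r" "\<epsilon> > 0" "x \<in> payoff_hull p r" "x $ j \<le> x $ i"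
  shows "profile_payoff p r (good_strategy p r \<epsilon>) x $ i
    \<le> profile_payoff p r (good_strategy p r \<epsilon>) x $ j"
proof -
  let ?a = "\<lambda>i. good_strategy p r \<epsilon> i x"
  define n where "n = card {j. ?a j = Invest}"
  have "p n \<le> r n" if "?a i = Invest" "?a j \<noteq> Invest"
  proof -
    have "n = 1 \<or> n = 2"
      using card_investors_pos[of ?a, OF that(1)] card_investors_less[of ?a, OF that(2)]
      unfolding n_def by linarith
    then show ?thesis
      using assms(1) by (auto simp: admissible_payoffs_def)
  qed
  then show ?thesis
    using richer_invests[OF assms(2-4)]
    by (auto simp: profile_payoff_def payoff_def n_def Let_def)
qed

lemma payoff_bounded:
  obtains M where "\<And>a i. \<bar>payoff p r a $ i\<bar> \<le> M"
proof
  fix a i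
  define n where "n = card {j :: 3. a j = Invest}"
  have "n \<le> 3" unfolding n_def by (rule card_investors_le)
  then have "\<bar>p n\<bar> + \<bar>r n\<bar> \<le> (\<Sum>m\<le>3. \<bar>p m\<bar> + \<bar>r m\<bar>)"
    using member_le_sum[of n "{..3}" "\<lambda>m. \<bar>p m\<bar> + \<bar>r m\<bar>"] by simp
  then show "\<bar>payoff p r a $ i\<bar> \<le> (\<Sum>m\<le>3. \<bar>p m\<bar> + \<bar>r m\<bar>)"
    by (auto simp: payoff_def n_def[symmetric] Let_def)
qed

text \<open>After clearing denominators, each round adds its payoff to \<open>n\<close> times the
  mean. The dummy value at index 0 forces \<open>n \<ge> 1\<close>.\<close>

lemma scaled_trajectory_Suc:
  assumes "n \<ge> 1"
  shows "real (Suc n) *\<^sub>R trajectory p r s x\<^sub>1 (Suc n) =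
    real n *\<^sub>R trajectory p r s x\<^sub>1 n + profile_payoff p r s (trajectory p r s x\<^sub>1 n)"
  using assms by (simp add: add.commute)

theorem theorem3p1:
  fixes p r :: "nat \<Rightarrow> real" and \<epsilon> :: real and x\<^sub>1 :: "real ^ 3"
  assumes "admissible_payoffs p r"
    and "\<epsilon> > 0"
    and "x\<^sub>1 \<in> payoff_hull p r"
  shows "(\<lambda>T. trajectory p r (good_strategy p r \<epsilon>) x\<^sub>1 T) \<longlonglongrightarrow> vector [p 3, p 3, p 3]"
proof -
  let ?s = "good_strategy p r \<epsilon>"
  define x where "x = trajectory p r ?s x\<^sub>1"
  define \<phi> where "\<phi> n = profile_payoff p r ?s (x n)" for n
  define \<sigma> where "\<sigma> n = (\<Sum>i\<in>UNIV. x n $ i)" for n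
  have xS: "x n \<in> payoff_hull p r" for n
    unfolding x_def by (rule trajectory_in_payoff_hull[OF assms(3)])
  have rec: "real (Suc n) * x (Suc n) $ i = real n * x n $ i + \<phi> n $ i" if "n \<ge> 1" for n i
    using arg_cong[OF scaled_trajectory_Suc[OF that, of p r ?s x\<^sub>1], of "\<lambda>v. v $ i"]
    by (simp only: x_def \<phi>_def vector_add_component vector_scaleR_component real_scaleR_def)
  have rec_sum: "real (Suc n) * \<sigma> (Suc n) = real n * \<sigma> n + (\<Sum>i\<in>UNIV. \<phi> n $ i)"
    if "n \<ge> 1" for n
    unfolding \<sigma>_def sum_distrib_left rec[OF that] by (simp add: sum.distrib)
  obtain M where M: "\<And>n i. \<bar>\<phi> n $ i\<bar> \<le> M"
    unfolding \<phi>_def profile_payoff_def using payoff_bounded[of p r] by metis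

  \<comment> \<open>Differences of coordinates\<close>
  define C where "C = Max (range (\<lambda>(i, j). max \<bar>x 1 $ i - x 1 $ j\<bar> (2 * M)))"
  have gap: "real n * \<bar>x n $ i - x n $ j\<bar> \<le> C" if "n \<ge> 1" for n i j
  proof -
    have "\<bar>real n * (x n $ i - x n $ j)\<bar> \<le> max \<bar>real 1 * (x 1 $ i - x 1 $ j)\<bar> (2 * M)"
    proof (rule bounded_of_restoring_steps[where e = "\<lambda>n. \<phi> n $ i - \<phi> n $ j", OF _ _ _ _ that])
      show "real (Suc n) * (x (Suc n) $ i - x (Suc n) $ j) =
          real n * (x n $ i - x n $ j) + (\<phi> n $ i - \<phi> n $ j)" if "n \<ge> 1" for n
        using rec[OF that, of i] rec[OF that, of j] by (simp only: right_diff_distrib)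
      show "\<bar>\<phi> n $ i - \<phi> n $ j\<bar> \<le> 2 * M" for n
        using M[of n i] M[of n j] by linarith
      show "\<phi> n $ i - \<phi> n $ j \<le> 0" if "n \<ge> 1" "0 \<le> real n * (x n $ i - x n $ j)" for n
        using that richer_earns_less[OF assms(1,2) xS[of n], of j i]
        by (simp add: \<phi>_def zero_le_mult_iff)
      show "0 \<le> \<phi> n $ i - \<phi> n $ j" if "n \<ge> 1" "real n * (x n $ i - x n $ j) \<le> 0" for n
        using that richer_earns_less[OF assms(1,2) xS[of n], of i j]
        by (simp add: \<phi>_def mult_le_0_iff)
    qed
    also have "\<dots> \<le> C"
      \<comment> \<open>The maximum over all pairs makes \<open>C\<close> independent of the
        players.\<close>
      unfolding C_def by (rule Max_ge) (auto intro!: image_eqI[of _ _ "(i, j)"])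
    finally show ?thesis by (simp add: abs_mult)
  qed

  have mean_gap: "real n * \<bar>3 * x n $ i - \<sigma> n\<bar> \<le> 3 * C" if "n \<ge> 1" for n i
  proof -
    have "real n * \<bar>3 * x n $ i - \<sigma> n\<bar> = real n * \<bar>\<Sum>j\<in>UNIV. x n $ i - x n $ j\<bar>"
      by (simp add: \<sigma>_def sum_subtractf)
    also have "\<dots> \<le> real n * (\<Sum>j\<in>UNIV. \<bar>x n $ i - x n $ j\<bar>)"
      by (intro mult_left_mono sum_abs) simp
    also have "\<dots> \<le> (\<Sum>j\<in>(UNIV :: 3 set). C)"
      unfolding sum_distrib_left by (intro sum_mono gap[OF that])
    finally show ?thesis by simp
  qed

  \<comment> \<open>Lower bound on the coordinate sum\<close>
  define c where "c = p 1 + 2 * r 1"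
  have c: "c > 3 * r 0"
    using assms(1) by (simp add: c_def admissible_payoffs_def)
  have \<sigma>_lower: "real n * (c - \<sigma> n) \<le> max (c - \<sigma> 1) 0" if "n \<ge> 1" for n
  proof -
    \<comment> \<open>The scaled shortfall below \<open>c\<close> cannot grow, because every round
      pays at least \<open>c\<close> in total.\<close>
    have step: "real (Suc n) * (c - \<sigma> (Suc n)) \<le> max (real n * (c - \<sigma> n)) 0" if "n \<ge> 1" for n
    proof -
      obtain i where "?s i (x n) = Invest"
        using ex_investor[OF assms(1,2) xS] .
      then have "c \<le> (\<Sum>i\<in>UNIV. \<phi> n $ i)"
        unfolding c_def \<phi>_def profile_payoff_def by (rule sum_payoff_ge_of_investor[OF assms(1)])
      then show ?thesis
        using rec_sum[OF that] by (simp add: algebra_simps)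
    qed
    show ?thesis
      using le_max_of_step_le_max[of 1 "\<lambda>n. real n * (c - \<sigma> n)" 0, OF step that] by simp
  qed

  \<comment> \<open>Late rounds in which a player abstains\<close>
  define L where "L = max (c - \<sigma> 1) 0"
  \<comment> \<open>The first threshold brings the gap bound \<open>C / n\<close> below
    \<open>\<epsilon>\<close>; the second makes \<open>c - (L + 3 * C) / n\<close>, a lower bound
    for \<open>3 * x n $ i\<close>, exceed \<open>3 * r 0\<close>.\<close>
  have "\<forall>\<^sub>F n in sequentially. real n > max (C / \<epsilon>) ((L + 3 * C) / (c - 3 * r 0))"
    using filterlim_real_sequentially unfolding filterlim_at_top_dense by blast
  then obtain N\<^sub>0 where N\<^sub>0: "\<And>n. n \<ge> N\<^sub>0 \<Longrightarrow> real n > max (C / \<epsilon>) ((L + 3 * C) / (c - 3 * r 0))"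
    unfolding eventually_sequentially by blast
  define N where "N = max N\<^sub>0 1"

  have abstention: "real n * (3 * p 3 - \<sigma> n) \<le> 3 * C" if "n \<ge> N" "?s i (x n) \<noteq> Invest" for n i
  proof -
    have n: "n \<ge> 1" "real n > 0" "real n * \<epsilon> > C" "real n * (c - 3 * r 0) > L + 3 * C"
      using that(1) N\<^sub>0[of n] \<open>\<epsilon> > 0\<close> c by (auto simp: N_def pos_divide_less_eq)
    have "x n $ i > x n $ j - \<epsilon>" for j
    proof -
      have "real n * \<bar>x n $ j - x n $ i\<bar> < real n * \<epsilon>"
        using gap[OF n(1), of j i] n(3) by linarith
      then show ?thesis using n(2) by simp
    qed
    moreover have "x n $ i \<ge> r 0"
    proof -
      have "real n * (\<sigma> n - 3 * x n $ i) \<le> 3 * C"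
        using mean_gap[OF n(1), of i] mult_left_mono[of "\<sigma> n - 3 * x n $ i" "\<bar>3 * x n $ i - \<sigma> n\<bar>" "real n"]
        by linarith
      then have "real n * (3 * r 0) < real n * (3 * x n $ i)"
        using \<sigma>_lower[OF n(1)] n(4) by (simp add: L_def algebra_simps)
      then show ?thesis using n(2) by simp
    qed
    ultimately have "\<sigma> n - x n $ i > 2 * p 3"
      using that(2) unfolding good_strategy_invest_iff[OF xS] \<sigma>_def by auto
    \<comment> \<open>Triple the preceding inequality and subtract \<open>2 * \<sigma> n\<close>:
      the deficit of the total is controlled by the distance of player \<open>i\<close> from the
      mean.\<close>
    then have "2 * (3 * p 3 - \<sigma> n) \<le> \<sigma> n - 3 * x n $ i"
      by (simp add: algebra_simps)
    also have "\<dots> \<le> \<bar>3 * x n $ i - \<sigma> n\<bar>"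
      by simp
    finally have "real n * (2 * (3 * p 3 - \<sigma> n)) \<le> real n * \<bar>3 * x n $ i - \<sigma> n\<bar>"
      by (intro mult_left_mono) simp_all
    also have "\<dots> \<le> 3 * C"
      by (rule mean_gap[OF n(1)])
    finally have "2 * (real n * (3 * p 3 - \<sigma> n)) \<le> 3 * C"
      by (simp only: mult.left_commute)
    moreover have "0 \<le> real n * (3 * p 3 - \<sigma> n)"
      using payoff_hull_sum_bounds(2)[OF assms(1) xS] by (simp add: \<sigma>_def)
    ultimately show ?thesis by linarith
  qed

  \<comment> \<open>A round with an abstainer starts from a scaled deficit of at most
    \<open>3 * C\<close> and pays at least \<open>3 * r 0\<close> in total, so it ends at most at
    \<open>K\<close>.\<close>
  define K where "K = 3 * C + (3 * p 3 - 3 * r 0)"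
  have K: "real n * (3 * p 3 - \<sigma> n) \<le> max (real N * (3 * p 3 - \<sigma> N)) K" if "n \<ge> N" for n
  proof (rule le_max_of_step_le_max[OF _ that])
    fix n assume "n \<ge> N"
    then have "n \<ge> 1" by (simp add: N_def)
    have step: "real (Suc n) * (3 * p 3 - \<sigma> (Suc n)) =
        real n * (3 * p 3 - \<sigma> n) + (3 * p 3 - (\<Sum>i\<in>UNIV. \<phi> n $ i))"
      using rec_sum[OF \<open>n \<ge> 1\<close>] by (simp add: algebra_simps)
    show "real (Suc n) * (3 * p 3 - \<sigma> (Suc n)) \<le> max (real n * (3 * p 3 - \<sigma> n)) K"
    proof (cases "\<forall>i. ?s i (x n) = Invest")
      case True
      then have "(\<Sum>i\<in>UNIV. \<phi> n $ i) = 3 * p 3"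
        unfolding \<phi>_def profile_payoff_def by (intro sum_payoff_all_invest) simp
      then show ?thesis unfolding step by simp
    next
      case False
      then obtain i where "?s i (x n) \<noteq> Invest"
        by blast
      with \<open>n \<ge> N\<close> have "real n * (3 * p 3 - \<sigma> n) \<le> 3 * C"
        by (rule abstention)
      moreover have "3 * r 0 \<le> (\<Sum>i\<in>UNIV. \<phi> n $ i)"
        unfolding \<phi>_def profile_payoff_def by (rule sum_payoff_bounds[OF assms(1)])
      ultimately show ?thesis
        unfolding step K_def by linarith
    qed
  qed

  \<comment> \<open>Convergence at rate 1/n\<close>
  define K' where "K' = max (real N * (3 * p 3 - \<sigma> N)) K"
  have "(\<lambda>n. x n $ i - p 3) \<longlonglongrightarrow> 0" for i
  proof (rule Lim_null_comparison)
    show "\<forall>\<^sub>F n in sequentially. norm (x n $ i - p 3) \<le> (3 * C + K') / real n"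
    proof (rule eventually_sequentiallyI)
      fix n assume "n \<ge> N"
      then have n: "n \<ge> 1" "real n > 0" by (simp_all add: N_def)
      \<comment> \<open>Here \<open>3 * (x n $ i - p 3)\<close> is
        \<open>3 * x n $ i - \<sigma> n\<close> minus the nonnegative deficit
        \<open>3 * p 3 - \<sigma> n\<close>.\<close>
      have "\<bar>x n $ i - p 3\<bar> \<le> \<bar>3 * x n $ i - \<sigma> n\<bar> + (3 * p 3 - \<sigma> n)"
        using payoff_hull_sum_bounds(2)[OF assms(1) xS, of n] unfolding \<sigma>_def by linarith
      then have "real n * \<bar>x n $ i - p 3\<bar> \<le>
          real n * \<bar>3 * x n $ i - \<sigma> n\<bar> + real n * (3 * p 3 - \<sigma> n)"
        using n(2) by (simp flip: distrib_left)
      also have "\<dots> \<le> 3 * C + K'"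
        unfolding K'_def by (intro add_mono mean_gap[OF n(1)] K[OF \<open>n \<ge> N\<close>])
      finally show "norm (x n $ i - p 3) \<le> (3 * C + K') / real n"
        using n(2) by (simp add: pos_le_divide_eq mult.commute)
    qed
    show "(\<lambda>n. (3 * C + K') / real n) \<longlonglongrightarrow> 0"
      by (rule lim_const_over_n)
  qed
  then have "(\<lambda>n. x n $ i) \<longlonglongrightarrow> p 3" for i
    by (simp add: LIM_zero_iff)
  moreover have "(vector [p 3, p 3, p 3] :: real ^ 3) $ i = p 3" for i
    using exhaust_3[of i] by auto
  ultimately show ?thesis
    unfolding x_def by (intro vec_tendstoI) simp
qed

end
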